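(* There exists a continuous curve $d_{\mathrm{bc}}: [0,1] \to [0, \frac{1}{24}]$ with $d_{\mathrm{bc}}(\frac{1}{2}) = \frac{1}{24}$ and $d_{\mathrm{bc}}(1 - a) = d_{\mathrm{bc}}(a)$ so that for every $0 < a < 1$ and $0 \le d < d_{\mathrm{bc}}(a)$ the system $G(\overline{u}, \overline{v}; a, d) = 0$ has nine distinct solutions $(\overline{u},\overline{v}) \in [0, 1]^2$. Upon writing $$\Omega_{\mathrm{bc}} = \{ (a,d) : 0 < a < 1 \text{ and } 0 < d < d_{\mathrm{bc}}(a) \},$$ there exist $C^\infty$-smooth maps $(\overline{u}_{\mathrm{bc}}, \overline{v}_{\mathrm{bc}}): \Omega_{\mathrm{bc}} \to (0, 1)^2$ with $\overline{u}_{\mathrm{bc}} (a,d)< a < \overline{v}_{\mathrm{bc}}(a,d)$ so that for every $(a, d) \in \Omega_{\mathrm{bc}}$ we have $$G\big( \overline{u}_{\mathrm{bc}}(a , d), \overline{v}_{\mathrm{bc}}(a, d) ;a ,d \big) = 0$$ together with $$\det D_{1,2} G\big( \overline{u}_{\mathrm{bc}}(a , d), \overline{v}_{\mathrm{bc}}(a, d) ;a ,d \big) >0, \qquad \mathrm{Tr}\, D_{1,2} G\big( \overline{u}_{\mathrm{bc}}(a , d), \overline{v}_{\mathrm{bc}}(a, d) ;a ,d \big) <0 .$$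
   Context: Let $g(u;a) = u(1-u)(u-a)$ and $$G(u,v;a,d) = \begin{pmatrix} G_1(u,v;a,d) \\ G_2(u,v;a,d) \end{pmatrix} = \begin{pmatrix} 2d(v-u) + g(u;a) \\ 2d(u-v) + g(v;a) \end{pmatrix}.$$ $D_{1,2}G$ denotes the $2\times 2$ Jacobian matrix of $G$ with respect to $(u,v)$. *)

theory Defs
  imports "HOL-Analysis.Analysis"
begin

definition g :: "real \<Rightarrow> real \<Rightarrow> real" where
  "g u a = u * (1 - u) * (u - a)"

definition G\<^sub>1 :: "real \<Rightarrow> real \<Rightarrow> real \<Rightarrow> real \<Rightarrow> real" where
  "G\<^sub>1 u v a d = 2 * d * (v - u) + g u a"

definition G\<^sub>2 :: "real \<Rightarrow> real \<Rightarrow> real \<Rightarrow> real \<Rightarrow> real" where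
  "G\<^sub>2 u v a d = 2 * d * (u - v) + g v a"

definition G :: "real \<Rightarrow> real \<Rightarrow> real \<Rightarrow> real \<Rightarrow> real^2" where
  "G u v a d = vector [G\<^sub>1 u v a d, G\<^sub>2 u v a d]"

definition D12G :: "real \<Rightarrow> real \<Rightarrow> real \<Rightarrow> real \<Rightarrow> real^2^2" where
  "D12G u v a d = jacobian (\<lambda>x :: real^2. G (x $ 1) (x $ 2) a d) (at (vector [u, v]))"

definition \<Omega>_bc :: "(real \<Rightarrow> real) \<Rightarrow> (real \<times> real) set" where
  "\<Omega>_bc d_bc = {(a, d). 0 < a \<and> a < 1 \<and> 0 < d \<and> d < d_bc a}"

text \<open>
  \<open>Ck_on k S f\<close> says that \<open>f\<close> is of class \<open>C\<^sup>k\<close> on \<open>S\<close>. It is meant for open \<open>S\<close>, since the derivatives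
  are taken in the ambient space. In finite dimensions, continuity of all directional derivatives
  \<open>x \<mapsto> Df(x) v\<close> amounts to continuity of \<open>x \<mapsto> Df(x)\<close> in operator norm, so the recursion can proceed
  direction by direction and stay within maps into the same space.
\<close>

fun Ck_on :: "nat \<Rightarrow> 'a::euclidean_space set \<Rightarrow> ('a \<Rightarrow> 'b::euclidean_space) \<Rightarrow> bool" where
  "Ck_on 0 S f \<longleftrightarrow> continuous_on S f"
| "Ck_on (Suc k) S f \<longleftrightarrow>
     (\<forall>x\<in>S. f differentiable (at x)) \<and>
     (\<forall>v. Ck_on k S (\<lambda>x. frechet_derivative f (at x) v))"

definition smooth_on :: "'a::euclidean_space set \<Rightarrow> ('a \<Rightarrow> 'b::euclidean_space) \<Rightarrow> bool" where
  "smooth_on S f \<longleftrightarrow> (\<forall>k. Ck_on k S f)"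

end

(*
  In the coordinates s = u + v and u - v the difference G1 - G2 factors through u - v, so off the
  diagonal it determines (u - v)^2 as a function of s. Inserting this into G1 + G2 leaves a depressed
  cubic in a shift t of s. Below d_bc its discriminant gives three real roots t, each with
  (u - v)^2 > 0; together with the three zeros of g on the diagonal this makes nine equilibria. On a
  root, with p the linear coefficient of the cubic, det = (3t^2 + p)(3t^2 + 4p - 8d) and
  trace = 3t^2 + 4p - 4d, so the middle root, where 3t^2 + p < 0, is the stable one. Viete's
  trigonometric formula expresses it explicitly, which makes its smoothness a matter of composition.
*)

theory Submission
  imports Defs
begin

section \<open>Calculus of \<open>C\<^sup>k\<close> functions\<close>

text \<open>Openness makes the two functions agree near each point of \<open>S\<close>, so their
  ambient derivatives coincide and the recursion can descend.\<close>

lemma Ck_on_cong: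
  assumes "open S" "Ck_on k S f" "\<And>x. x \<in> S \<Longrightarrow> f x = h x"
  shows "Ck_on k S h"
  using assms(2,3)
proof (induction k arbitrary: f h)
  case 0
  then show ?case by (simp cong: continuous_on_cong)
next
  case (Suc k)
  have deriv: "(h has_derivative frechet_derivative f (at x)) (at x)" if "x \<in> S" for x
  proof -
    have "(f has_derivative frechet_derivative f (at x)) (at x)"
      using Suc.prems(1) that by (simp add: frechet_derivative_works)
    then show ?thesis
      by (rule has_derivative_transform_within_open[OF _ assms(1) that]) (use Suc.prems in auto)
  qed
  then have eq: "frechet_derivative f (at x) = frechet_derivative h (at x)" if "x \<in> S" for x
    using that frechet_derivative_at by blast
  have "Ck_on k S (\<lambda>x. frechet_derivative h (at x) v)" for v
    by (rule Suc.IH[of "\<lambda>x. frechet_derivative f (at x) v"]) (use Suc.prems(1) eq in auto)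
  then show ?case
    using deriv by (auto simp: differentiable_def)
qed

text \<open>Introduction rule for the closure lemmas below: by uniqueness of derivatives, any
  explicit formula \<open>f'\<close> may stand in for \<open>frechet_derivative\<close>.\<close>

lemma Ck_on_SucI:
  assumes "open S" "\<And>x. x \<in> S \<Longrightarrow> (f has_derivative f' x) (at x)"
    and "\<And>v. Ck_on k S (\<lambda>x. f' x v)"
  shows "Ck_on (Suc k) S f"
proof -
  have "Ck_on k S (\<lambda>x. frechet_derivative f (at x) v)" for v
    by (rule Ck_on_cong[OF assms(1) assms(3)[of v]])
      (simp add: frechet_derivative_at[OF assms(2), symmetric])
  then show ?thesis
    using assms(2) by (auto simp: differentiable_def)
qed

lemma Ck_on_SucD:
  assumes "Ck_on (Suc k) S f"
  shows "x \<in> S \<Longrightarrow> (f has_derivative frechet_derivative f (at x)) (at x)"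
    and "Ck_on k S (\<lambda>x. frechet_derivative f (at x) v)"
  using assms by (auto simp: frechet_derivative_works)

text \<open>Product and chain rules leave undifferentiated factors, which this brings down to order
  \<open>k\<close>.\<close>

lemma Ck_on_Suc_lower: "Ck_on (Suc k) S f \<Longrightarrow> Ck_on k S f"
proof (induction k arbitrary: f)
  case 0
  then show ?case
    by (auto intro!: continuous_at_imp_continuous_on differentiable_imp_continuous_within)
next
  case (Suc k)
  then show ?case by (metis Ck_on.simps(2))
qed

lemma Ck_on_const: "open S \<Longrightarrow> Ck_on k S (\<lambda>x. c)"
proof (induction k arbitrary: c)
  case (Suc k)
  show ?case by (rule Ck_on_SucI[OF Suc.prems has_derivative_const]) (use Suc in auto)
qed auto

lemma Ck_on_bounded_linear:
  assumes "open S" "bounded_linear f"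
  shows "Ck_on k S f"
proof (cases k)
  case 0
  then show ?thesis by (simp add: assms(2) linear_continuous_on)
next
  case (Suc n)
  show ?thesis unfolding Suc
    by (rule Ck_on_SucI[OF assms(1) bounded_linear_imp_has_derivative[OF assms(2)]])
      (simp add: Ck_on_const assms(1))
qed

lemma Ck_on_add:
  assumes "open S" "Ck_on k S f" "Ck_on k S h"
  shows "Ck_on k S (\<lambda>x. f x + h x)"
  using assms(2,3)
proof (induction k arbitrary: f h)
  case 0
  then show ?case by (simp add: continuous_on_add)
next
  case (Suc k)
  show ?case
    by (rule Ck_on_SucI[OF assms(1) has_derivative_add[OF Suc.prems[THEN Ck_on_SucD(1)]]],
        assumption, assumption) (intro Suc.IH Suc.prems[THEN Ck_on_SucD(2)])
qed

lemma Ck_on_Pair: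
  assumes "open S" "Ck_on k S f" "Ck_on k S h"
  shows "Ck_on k S (\<lambda>x. (f x, h x))"
  using assms(2,3)
proof (induction k arbitrary: f h)
  case 0
  then show ?case by (simp add: continuous_on_Pair)
next
  case (Suc k)
  show ?case
    by (rule Ck_on_SucI[OF assms(1) has_derivative_Pair[OF Suc.prems[THEN Ck_on_SucD(1)]]],
        assumption, assumption) (intro Suc.IH Suc.prems[THEN Ck_on_SucD(2)])
qed

lemma Ck_on_mult:
  fixes f h :: "'a::euclidean_space \<Rightarrow> real"
  assumes "open S" "Ck_on k S f" "Ck_on k S h"
  shows "Ck_on k S (\<lambda>x. f x * h x)"
  using assms(2,3)
proof (induction k arbitrary: f h)
  case 0
  then show ?case by (simp add: continuous_on_mult)
next
  case (Suc k)
  show ?case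
  proof (rule Ck_on_SucI[OF assms(1) has_derivative_mult[OF Suc.prems[THEN Ck_on_SucD(1)]]])
    show "Ck_on k S (\<lambda>x. f x * frechet_derivative h (at x) v +
        frechet_derivative f (at x) v * h x)" for v
      by (intro Ck_on_add[OF assms(1)] Suc.IH Suc.prems[THEN Ck_on_Suc_lower]
          Suc.prems[THEN Ck_on_SucD(2)])
  qed
qed

text \<open>Chain rule arranged for induction on \<open>k\<close>: regularity is asked only of
  \<open>h'\<close> composed with \<open>f\<close>, which for elementary \<open>h\<close> is built
  from functions already known to be of class \<open>k\<close>.\<close>

lemma Ck_on_compose_Suc:
  fixes f :: "'a::euclidean_space \<Rightarrow> real" and h h' :: "real \<Rightarrow> real"
  assumes "open S" "Ck_on (Suc k) S f"
    and "\<And>x. x \<in> S \<Longrightarrow> (h has_real_derivative h' (f x)) (at (f x))"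
    and "Ck_on k S (\<lambda>x. h' (f x))"
  shows "Ck_on (Suc k) S (\<lambda>x. h (f x))"
proof (rule Ck_on_SucI[OF assms(1)])
  fix x assume x: "x \<in> S"
  show "((\<lambda>x. h (f x)) has_derivative (\<lambda>v. h' (f x) * frechet_derivative f (at x) v)) (at x)"
    by (rule has_derivative_compose[OF Ck_on_SucD(1)[OF assms(2) x]])
      (use assms(3)[OF x] in \<open>simp add: has_field_derivative_def\<close>)
next
  show "Ck_on k S (\<lambda>x. h' (f x) * frechet_derivative f (at x) v)" for v
    by (rule Ck_on_mult[OF assms(1,4) Ck_on_SucD(2)[OF assms(2)]])
qed

lemma Ck_on_inverse:
  fixes f :: "'a::euclidean_space \<Rightarrow> real"
  assumes "open S" "\<And>x. x \<in> S \<Longrightarrow> f x \<noteq> 0"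
  shows "Ck_on k S f \<Longrightarrow> Ck_on k S (\<lambda>x. inverse (f x))"
proof (induction k)
  case 0
  then show ?case using assms(2) by (simp add: continuous_on_inverse)
next
  case (Suc k)
  note inv = Suc.IH[OF Ck_on_Suc_lower[OF Suc.prems]]
  show ?case
  proof (rule Ck_on_compose_Suc[OF assms(1) Suc.prems])
    \<comment> \<open>The derivative is a polynomial in the inverse itself, so the induction
      hypothesis covers it; it is spelled with products to fit \<open>Ck_on_mult\<close>.\<close>
    show "(inverse has_real_derivative - 1 * (inverse (f x) * inverse (f x))) (at (f x))"
      if "x \<in> S" for x
      using DERIV_inverse[OF assms(2)[OF that]] by (simp add: power2_eq_square)
    show "Ck_on k S (\<lambda>x. - 1 * (inverse (f x) * inverse (f x)))"
      by (intro Ck_on_mult Ck_on_const assms(1) inv)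
  qed
qed

lemma Ck_on_sqrt:
  fixes f :: "'a::euclidean_space \<Rightarrow> real"
  assumes "open S" "\<And>x. x \<in> S \<Longrightarrow> f x > 0"
  shows "Ck_on k S f \<Longrightarrow> Ck_on k S (\<lambda>x. sqrt (f x))"
proof (induction k)
  case 0
  then show ?case by (simp add: continuous_on_real_sqrt)
next
  case (Suc k)
  note root = Suc.IH[OF Ck_on_Suc_lower[OF Suc.prems]]
  show ?case
  proof (rule Ck_on_compose_Suc[OF assms(1) Suc.prems])
    show "(sqrt has_real_derivative inverse (sqrt (f x)) * (1/2)) (at (f x))" if "x \<in> S" for x
      using DERIV_real_sqrt[OF assms(2)[OF that]] by simp
    have "sqrt (f x) \<noteq> 0" if "x \<in> S" for x
      using assms(2)[OF that] by simp
    then show "Ck_on k S (\<lambda>x. inverse (sqrt (f x)) * (1/2))"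
      by (intro Ck_on_mult Ck_on_const Ck_on_inverse assms(1) root)
  qed
qed

text \<open>The derivative \<open>1 / sqrt (1 - y^2)\<close> is algebraic, so the earlier rules
  settle it and a case split replaces the induction.\<close>

lemma Ck_on_arcsin:
  fixes f :: "'a::euclidean_space \<Rightarrow> real"
  assumes "open S" "\<And>x. x \<in> S \<Longrightarrow> \<bar>f x\<bar> < 1" "Ck_on k S f"
  shows "Ck_on k S (\<lambda>x. arcsin (f x))"
proof (cases k)
  case 0
  then show ?thesis
    using assms(2,3) by (force intro!: continuous_on_arcsin)
next
  case (Suc n)
  have pos: "0 < 1 + - 1 * (f x * f x)" if "x \<in> S" for x
    using assms(2)[OF that] by (simp add: abs_square_less_1 flip: power2_eq_square)
  have "Ck_on n S (\<lambda>x. inverse (sqrt (1 + - 1 * (f x * f x))))"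
    by (intro Ck_on_inverse Ck_on_sqrt Ck_on_mult Ck_on_add Ck_on_const assms(1) pos
        assms(3)[unfolded Suc, THEN Ck_on_Suc_lower]) (use pos in force)
  then show ?thesis
    unfolding Suc
    by (intro Ck_on_compose_Suc[OF assms(1) assms(3)[unfolded Suc],
          where h' = "\<lambda>y. inverse (sqrt (1 + - 1 * (y * y)))"])
      (use assms(2) DERIV_arcsin in \<open>force simp: power2_eq_square abs_less_iff\<close>)+
qed

text \<open>Sine and cosine are each other's derivative up to sign, hence one joint
  induction.\<close>

lemma Ck_on_sin_cos:
  fixes f :: "'a::euclidean_space \<Rightarrow> real"
  assumes "open S"
  shows "Ck_on k S f \<Longrightarrow> Ck_on k S (\<lambda>x. sin (f x)) \<and> Ck_on k S (\<lambda>x. cos (f x))"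
proof (induction k)
  case 0
  then show ?case by (simp add: continuous_on_sin continuous_on_cos)
next
  case (Suc k)
  note trig = Suc.IH[OF Ck_on_Suc_lower[OF Suc.prems]]
  have "Ck_on k S (\<lambda>x. - 1 * sin (f x))"
    by (intro Ck_on_mult Ck_on_const assms) (use trig in auto)
  with trig have "Ck_on (Suc k) S (\<lambda>x. cos (f x))"
    by (intro Ck_on_compose_Suc[OF assms Suc.prems, where h' = "\<lambda>y. - 1 * sin y"])
      (auto intro!: derivative_eq_intros)
  moreover have "Ck_on (Suc k) S (\<lambda>x. sin (f x))"
    using trig by (intro Ck_on_compose_Suc[OF assms Suc.prems, where h' = cos])
      (auto intro!: derivative_eq_intros)
  ultimately show ?case by blast
qed

lemma Ck_on_diff:
  fixes f h :: "'a::euclidean_space \<Rightarrow> real"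
  assumes "open S" "Ck_on k S f" "Ck_on k S h"
  shows "Ck_on k S (\<lambda>x. f x - h x)"
  using Ck_on_add[OF assms(1,2) Ck_on_mult[OF assms(1) Ck_on_const[OF assms(1)] assms(3)], of "-1"]
  by simp

lemma Ck_on_divide:
  fixes f h :: "'a::euclidean_space \<Rightarrow> real"
  assumes "open S" "Ck_on k S f" "Ck_on k S h" "\<And>x. x \<in> S \<Longrightarrow> h x \<noteq> 0"
  shows "Ck_on k S (\<lambda>x. f x / h x)"
  using Ck_on_mult[OF assms(1,2) Ck_on_inverse[OF assms(1,4,3)]] by (simp add: divide_inverse)

lemma Ck_on_power:
  fixes f :: "'a::euclidean_space \<Rightarrow> real"
  assumes "open S" "Ck_on k S f"
  shows "Ck_on k S (\<lambda>x. f x ^ n)"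
  by (induction n) (simp_all add: Ck_on_const Ck_on_mult assms)

section \<open>The middle root of a cubic\<close>

text \<open>Viete's formula for \<open>t^3 + p t + q\<close>, with arcsin in place of arccos: its
  range puts the angle in \<open>[-pi/6, pi/6]\<close>, which selects the root between the critical
  points \<open>sqrt (- p / 3)\<close> and its negative.\<close>

definition mid_root :: "real \<Rightarrow> real \<Rightarrow> real" where
  "mid_root p q = 2 * sqrt (- p / 3) * sin (arcsin (q / (2 * sqrt (- p / 3) ^ 3)) / 3)"

lemma sin_triple: "sin (3 * x) = 3 * sin x - 4 * sin x ^ 3" for x :: real
proof -
  have "sin (3 * x) = sin (2 * x + x)" by simp
  then have "sin (3 * x) = 2 * sin x * cos x * cos x + (1 - 2 * (sin x)\<^sup>2) * sin x"
    by (simp only: sin_add sin_double cos_double_sin)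
  then show ?thesis
    using sin_cos_squared_add[of x] by algebra
qed

text \<open>With \<open>r = sqrt (- p / 3)\<close> one has \<open>4 p^3 = - 108 r^6\<close>, so the
  hypothesis reads \<open>q^2 < (2 r^3)^2\<close>.\<close>

lemma cubic_arcsin_arg:
  fixes p q :: real
  assumes "4 * p ^ 3 + 27 * q\<^sup>2 < 0"
  shows "p < 0" "\<bar>q / (2 * sqrt (- p / 3) ^ 3)\<bar> < 1"
proof -
  have "p ^ 3 < 0"
    using assms zero_le_power2[of q] by linarith
  then show p: "p < 0"
    by (simp add: power_less_zero_eq)
  define r where "r = sqrt (- p / 3)"
  have r: "r > 0" and r2: "r\<^sup>2 = - p / 3"
    using p by (auto simp: r_def)
  have "(r ^ 3)\<^sup>2 = (r\<^sup>2) ^ 3" by (simp add: power_mult[symmetric])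
  also have "\<dots> = - (p ^ 3) / 27" by (simp add: r2 power_divide)
  finally have "q\<^sup>2 < (2 * r ^ 3)\<^sup>2"
    using assms by (simp add: power_mult_distrib)
  then have "\<bar>q\<bar> < 2 * r ^ 3"
    using r by (metis abs_le_square_iff abs_of_pos linorder_not_le zero_less_mult_iff
        zero_less_numeral zero_less_power)
  then show "\<bar>q / (2 * sqrt (- p / 3) ^ 3)\<bar> < 1"
    using r unfolding r_def by (simp add: abs_mult divide_less_eq)
qed

text \<open>Putting \<open>t = 2 r sin \<theta>\<close> and \<open>p = - 3 r^2\<close> turns
  \<open>t^3 + p t\<close> into \<open>- 2 r^3 sin (3 \<theta>)\<close>, which is \<open>- q\<close>
  by the choice of the angle. Strictness of the hypothesis gives an angle below \<open>pi/6\<close>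
  in modulus, hence a root below \<open>r\<close> in modulus.\<close>

lemma mid_root:
  fixes p q :: real
  assumes "4 * p ^ 3 + 27 * q\<^sup>2 < 0"
  shows "mid_root p q ^ 3 + p * mid_root p q + q = 0"
    and "3 * (mid_root p q)\<^sup>2 + p < 0"
proof -
  define r where "r = sqrt (- p / 3)"
  define y where "y = q / (2 * r ^ 3)"
  define \<theta> where "\<theta> = arcsin y / 3"
  note arg = cubic_arcsin_arg[OF assms, folded r_def, folded y_def]
  have r: "r > 0" and p: "p = - 3 * r\<^sup>2"
    using arg(1) by (auto simp: r_def)
  have t: "mid_root p q = 2 * r * sin \<theta>"
    by (simp add: mid_root_def r_def \<theta>_def y_def)
  have q: "q = 2 * r ^ 3 * y"
    using r by (simp add: y_def)
  have y: "3 * sin \<theta> - 4 * sin \<theta> ^ 3 = y"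
    using arg(2) by (simp add: \<theta>_def sin_triple[symmetric])
  show "mid_root p q ^ 3 + p * mid_root p q + q = 0"
    using q y unfolding t unfolding p by algebra
  have "- (pi / 2) < arcsin y" "arcsin y < pi / 2"
    using arcsin_lt_bounded[of y] arg(2) by auto
  then have th: "- (pi / 6) < \<theta>" "\<theta> < pi / 6"
    by (auto simp: \<theta>_def)
  have "sin \<theta> < 1 / 2"
    using sin_monotone_2pi[of \<theta> "pi / 6"] th pi_gt_zero by (simp add: sin_30)
  moreover have "sin \<theta> > - 1 / 2"
    using sin_monotone_2pi[of "- (pi / 6)" \<theta>] th pi_gt_zero by (simp add: sin_30)
  ultimately have "(sin \<theta>)\<^sup>2 < (1 / 2)\<^sup>2"
    by (metis abs_less_iff minus_divide_left minus_less_iff power2_abs power_strict_mono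
        abs_ge_zero zero_less_numeral)
  then have "(sin \<theta>)\<^sup>2 < 1 / 4"
    by (simp add: power_divide)
  then have "r\<^sup>2 * (sin \<theta>)\<^sup>2 < r\<^sup>2 * (1 / 4)"
    using r by (intro mult_strict_left_mono) auto
  then show "3 * (mid_root p q)\<^sup>2 + p < 0"
    unfolding t unfolding p by (simp add: power_mult_distrib)
qed

text \<open>Modulo the cubic, \<open>4 p^3 + 27 q^2\<close> equals the square of
  \<open>3 t^2 + p\<close> times \<open>3 t^2 + 4 p\<close>. The quantity
  \<open>- (3 t^2 + 4 p)\<close> is the discriminant of the quadratic left after dividing out the
  root \<open>t\<close>; its positivity also yields \<open>(u - v)^2 > 0\<close> later.\<close>

lemma cubic_root_bound:
  fixes p q t :: real
  assumes "4 * p ^ 3 + 27 * q\<^sup>2 < 0" "t ^ 3 + p * t + q = 0"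
  shows "3 * t\<^sup>2 + 4 * p < 0"
proof -
  have q: "q = - (t ^ 3) - p * t" using assms(2) by linarith
  have "(3 * t\<^sup>2 + p)\<^sup>2 * (3 * t\<^sup>2 + 4 * p) = 4 * p ^ 3 + 27 * q\<^sup>2"
    unfolding q by algebra
  with assms(1) show ?thesis
    by (metis mult_nonneg_nonneg not_le zero_le_power2)
qed

lemma card_cubic_roots:
  fixes p q :: real
  assumes "4 * p ^ 3 + 27 * q\<^sup>2 < 0"
  shows "card {t. t ^ 3 + p * t + q = 0} = 3"
proof -
  define m where "m = mid_root p q"
  define w where "w = sqrt (- (3 * m\<^sup>2 + 4 * p))"
  note m = mid_root[OF assms, folded m_def]
  have w: "w > 0" and w2: "w\<^sup>2 = - (3 * m\<^sup>2 + 4 * p)"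
    using cubic_root_bound[OF assms m(1)] by (auto simp: w_def)
  have q: "q = - (m ^ 3) - p * m" using m(1) by linarith
  have p: "p = - (w\<^sup>2 + 3 * m\<^sup>2) / 4" using w2 by simp
  have fact: "t ^ 3 + p * t + q = (t - m) * (t - (w - m) / 2) * (t - (- w - m) / 2)" for t
    unfolding q p by (simp add: field_simps power2_eq_square power3_eq_cube)
  \<comment> \<open>This is four times \<open>3 m^2 + p < 0\<close>; the middle root would meet
    another root only if \<open>3 m\<close> were \<open>w\<close> or \<open>- w\<close>.\<close>
  have "(3 * m)\<^sup>2 < w\<^sup>2"
    using m(2) w2 by (simp add: power_mult_distrib)
  then have "3 * m \<noteq> w" "3 * m \<noteq> - w"
    by (metis less_irrefl power2_minus)+
  then have ne: "m \<noteq> (w - m) / 2" "m \<noteq> (- w - m) / 2"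
    by auto
  have "{t. t ^ 3 + p * t + q = 0} = {m, (w - m) / 2, (- w - m) / 2}"
    unfolding fact by auto
  then show ?thesis using ne w by simp
qed

lemma Ck_on_mid_root:
  fixes p q :: "'a::euclidean_space \<Rightarrow> real"
  assumes "open S" "Ck_on k S p" "Ck_on k S q"
    and disc: "\<And>x. x \<in> S \<Longrightarrow> 4 * p x ^ 3 + 27 * (q x)\<^sup>2 < 0"
  shows "Ck_on k S (\<lambda>x. mid_root (p x) (q x))"
proof -
  note arg = cubic_arcsin_arg[OF disc]
  have "Ck_on k S (\<lambda>x. (0 - p x) / 3)"
    by (intro Ck_on_divide Ck_on_diff Ck_on_const assms(1,2)) auto
  then have r: "Ck_on k S (\<lambda>x. sqrt (- p x / 3))"
    by (intro Ck_on_sqrt assms(1)) (use arg(1) in auto)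
  have y: "Ck_on k S (\<lambda>x. q x / (2 * sqrt (- p x / 3) ^ 3))"
    by (intro Ck_on_divide Ck_on_mult Ck_on_power Ck_on_const assms(1,3) r) (use arg(1) in force)
  have "Ck_on k S (\<lambda>x. arcsin (q x / (2 * sqrt (- p x / 3) ^ 3)))"
    by (intro Ck_on_arcsin assms(1) arg(2) y)
  then have "Ck_on k S (\<lambda>x. arcsin (q x / (2 * sqrt (- p x / 3) ^ 3)) / 3)"
    by (rule Ck_on_divide[OF assms(1)]) (auto simp: Ck_on_const assms(1))
  then show ?thesis
    unfolding mid_root_def
    by (intro Ck_on_mult Ck_on_const r assms(1) Ck_on_sin_cos[THEN conjunct1])
qed

section \<open>Equilibria of the two-cell system\<close>

text \<open>Off the diagonal, \<open>G = 0\<close> means that \<open>t = u + v - 2(1 + a)/3\<close> is a root of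
  \<open>t^3 + pt + q\<close> with these coefficients, and that \<open>(u - v)^2 = 8d - 3t^2 - 4p\<close>.\<close>

definition cubic_p :: "real \<Rightarrow> real \<Rightarrow> real" where
  "cubic_p a d = 6 * d - (1 - a + a\<^sup>2) / 3"

definition cubic_q :: "real \<Rightarrow> real" where
  "cubic_q a = (1 + a) * (2 - a) * (1 - 2 * a) / 27"

text \<open>The value of \<open>d\<close> at which the discriminant of that cubic vanishes.\<close>

definition d_crit :: "real \<Rightarrow> real" where
  "d_crit a = (1 - a + a\<^sup>2) / 18 - root 3 ((cubic_q a)\<^sup>2 / 4) / 2"

section \<open>Symmetry and bounds of the critical coupling, and the sign of the discriminant below
  it\<close>

lemma continuous_on_d_crit: "continuous_on S d_crit"
  unfolding d_crit_def cubic_q_def by (intro continuous_intros) auto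

lemma d_crit_half: "d_crit (1 / 2) = 1 / 24"
  by (simp add: d_crit_def cubic_q_def power2_eq_square)

lemma d_crit_reflect: "d_crit (1 - a) = d_crit a"
proof -
  have "(cubic_q (1 - a))\<^sup>2 = (cubic_q a)\<^sup>2"
    unfolding cubic_q_def by algebra
  moreover have "1 - (1 - a) + (1 - a)\<^sup>2 = 1 - a + a\<^sup>2"
    by algebra
  ultimately show ?thesis
    by (simp add: d_crit_def)
qed

lemma one_minus_plus_square_pos: "0 < 1 - a + a\<^sup>2" for a :: real
proof -
  have "1 - a + a\<^sup>2 = (a - 1 / 2)\<^sup>2 + 3 / 4"
    by (simp add: power2_eq_square algebra_simps)
  then show ?thesis
    using zero_le_power2[of "a - 1 / 2"] by linarith
qed

lemma d_crit_bounds: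
  assumes "0 \<le> a" "a \<le> 1"
  shows "0 \<le> d_crit a" "d_crit a \<le> 1 / 24"
proof -
  \<comment> \<open>Times 108, the left side is the cubic's discriminant at \<open>d = 0\<close>.
    There the roots come from \<open>u + v\<close> equal to \<open>a\<close>, \<open>1\<close> or
    \<open>1 + a\<close>, with differences \<open>1 - a\<close>, \<open>a\<close> and
    \<open>1\<close>.\<close>
  have "((1 - a + a\<^sup>2) / 9) ^ 3 - (cubic_q a)\<^sup>2 / 4 = 27 * (a * (1 - a))\<^sup>2 / 2916"
    unfolding cubic_q_def by (simp add: field_simps) algebra
  then have "(cubic_q a)\<^sup>2 / 4 \<le> ((1 - a + a\<^sup>2) / 9) ^ 3"
    using zero_le_power2[of "a * (1 - a)"] by linarith
  then have "root 3 ((cubic_q a)\<^sup>2 / 4) \<le> root 3 (((1 - a + a\<^sup>2) / 9) ^ 3)"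
    by simp
  also have "\<dots> = (1 - a + a\<^sup>2) / 9"
    using one_minus_plus_square_pos[of a] by (intro real_root_power_cancel) auto
  finally show "0 \<le> d_crit a"
    by (simp add: d_crit_def)
next
  \<comment> \<open>As \<open>1 - a + a^2 = (x + 3) / 4\<close>, the bound amounts to
    \<open>x / 36\<close> being at most the cube root. Cubed, this is
    \<open>x^3 \<le> x (4 h)^2\<close>, which holds because \<open>x = 9 - 4 h\<close> and
    \<open>h \<ge> 2\<close>.\<close>
  define h where "h = (1 + a) * (2 - a)"
  define x where "x = (1 - 2 * a)\<^sup>2"
  have x: "x = 9 - 4 * h"
    unfolding x_def h_def by algebra
  have "h = 2 + a * (1 - a)"
    unfolding h_def by algebra
  then have h: "2 \<le> h"
    using assms by simp
  have "x \<ge> 0"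
    by (simp add: x_def)
  then have "x\<^sup>2 \<le> (4 * h)\<^sup>2"
    using h x by (intro power_mono) auto
  then have "x * x\<^sup>2 \<le> x * (4 * h)\<^sup>2"
    using \<open>x \<ge> 0\<close> by (rule mult_left_mono)
  moreover have "(cubic_q a)\<^sup>2 / 4 = x * (4 * h)\<^sup>2 / 46656"
    unfolding cubic_q_def x_def h_def by (simp add: power_mult_distrib power_divide)
  moreover have "(x / 36) ^ 3 = x * x\<^sup>2 / 46656"
    by (simp add: power3_eq_cube power2_eq_square)
  ultimately have "(x / 36) ^ 3 \<le> (cubic_q a)\<^sup>2 / 4"
    by simp
  then have "root 3 ((x / 36) ^ 3) \<le> root 3 ((cubic_q a)\<^sup>2 / 4)"
    by simp
  moreover have "root 3 ((x / 36) ^ 3) = x / 36"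
    using \<open>x \<ge> 0\<close> by (intro real_root_power_cancel) auto
  ultimately have root_ge: "x / 36 \<le> root 3 ((cubic_q a)\<^sup>2 / 4)"
    by simp
  have "(1 - a + a\<^sup>2) / 18 = x / 72 + 1 / 24"
    unfolding x_def by (simp add: field_simps power2_eq_square)
  then have "d_crit a = x / 72 + 1 / 24 - root 3 ((cubic_q a)\<^sup>2 / 4) / 2"
    by (simp only: d_crit_def)
  with root_ge show "d_crit a \<le> 1 / 24"
    by linarith
qed

text \<open>With \<open>c\<close> the cube root in \<open>d_crit\<close>, the hypothesis is exactly
  \<open>3 c < - p\<close>; cubing preserves it since \<open>c \<ge> 0\<close>.\<close>

lemma cubic_discriminant_neg:
  assumes "d < d_crit a"
  shows "4 * cubic_p a d ^ 3 + 27 * (cubic_q a)\<^sup>2 < 0"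
proof -
  define c where "c = root 3 ((cubic_q a)\<^sup>2 / 4)"
  have c: "c \<ge> 0" "c ^ 3 = (cubic_q a)\<^sup>2 / 4"
    by (auto simp: c_def)
  have "3 * c < - cubic_p a d"
    using assms by (simp add: d_crit_def cubic_p_def c_def)
  then have "(3 * c) ^ 3 < (- cubic_p a d) ^ 3"
    using c(1) by (intro power_strict_mono) auto
  then show ?thesis
    using c(2) by (simp add: power_mult_distrib)
qed

section \<open>Zeros of \<open>G\<close> on and off the diagonal, and their number\<close>

lemma G_eq_0_iff: "G u v a d = 0 \<longleftrightarrow> G\<^sub>1 u v a d = 0 \<and> G\<^sub>2 u v a d = 0"
  by (simp add: G_def vec_eq_iff forall_2)

lemma G_eq_0_diagonal: "G u u a d = 0 \<longleftrightarrow> u \<in> {0, a, 1}"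
  by (auto simp: G_eq_0_iff G\<^sub>1_def G\<^sub>2_def g_def)

lemma G_eq_0_off_diagonal:
  fixes u v a d :: real
  assumes "u \<noteq> v"
  defines "t \<equiv> u + v - 2 * (1 + a) / 3"
  shows "G u v a d = 0 \<longleftrightarrow> t ^ 3 + cubic_p a d * t + cubic_q a = 0 \<and>
    (u - v)\<^sup>2 = 8 * d - 3 * t\<^sup>2 - 4 * cubic_p a d"
proof -
  let ?w = "(u - v)\<^sup>2 - (8 * d - 3 * t\<^sup>2 - 4 * cubic_p a d)"
  let ?c = "t ^ 3 + cubic_p a d * t + cubic_q a"
  have diff: "4 * (G\<^sub>1 u v a d - G\<^sub>2 u v a d) = (v - u) * ?w"
    unfolding G\<^sub>1_def G\<^sub>2_def g_def cubic_p_def t_def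
    by (simp add: field_simps power2_eq_square)
  have sum: "4 * (G\<^sub>1 u v a d + G\<^sub>2 u v a d) = 8 * ?c - 3 * t * ?w"
    unfolding G\<^sub>1_def G\<^sub>2_def g_def cubic_p_def cubic_q_def t_def
    by (simp add: field_simps power2_eq_square power3_eq_cube)
  \<comment> \<open>The pair of identities is triangular: for \<open>u \<noteq> v\<close> the
    difference forces \<open>?w = 0\<close>, and the sum then reduces to
    \<open>8 * ?c\<close>.\<close>
  have "G u v a d = 0 \<longleftrightarrow>
      4 * (G\<^sub>1 u v a d - G\<^sub>2 u v a d) = 0 \<and> 4 * (G\<^sub>1 u v a d + G\<^sub>2 u v a d) = 0"
    unfolding G_eq_0_iff by auto
  also have "\<dots> \<longleftrightarrow> ?w = 0 \<and> ?c = 0"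
    unfolding diff sum using assms(1) by auto
  finally show ?thesis
    by auto
qed

lemma g_pos: "u < 0 \<Longrightarrow> 0 < a \<Longrightarrow> g u a > 0"
  unfolding g_def by (intro mult_neg_neg mult_neg_pos) auto

lemma g_neg: "1 < u \<Longrightarrow> a < 1 \<Longrightarrow> g u a < 0"
  unfolding g_def by (intro mult_pos_neg mult_neg_pos) (auto simp: mult_pos_neg)

text \<open>A discrete maximum principle: at the larger coordinate the coupling term is nonpositive,
  at the smaller one it is nonnegative.\<close>

lemma equilibrium_in_unit_square:
  assumes "0 < a" "a < 1" "0 \<le> d" "G u v a d = 0"
  shows "u \<in> {0..1} \<and> v \<in> {0..1}"
proof -
  have eq: "2 * d * (v - u) + g u a = 0" "2 * d * (u - v) + g v a = 0"
    using assms(4) by (auto simp: G_eq_0_iff G\<^sub>1_def G\<^sub>2_def)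
  have bounds: "0 \<le> x \<and> y \<le> 1"
    if "x \<le> y" "2 * d * (y - x) + g x a = 0" "2 * d * (x - y) + g y a = 0" for x y
  proof -
    have "2 * d * (y - x) \<ge> 0" "2 * d * (x - y) \<le> 0"
      using that(1) assms(3) by (auto intro: mult_nonneg_nonneg mult_nonneg_nonpos)
    then show ?thesis
      using that(2,3) g_pos[of x a] g_neg[of y a] assms(1,2) by (smt (verit))
  qed
  show ?thesis
    using bounds[of u v] bounds[of v u] eq by (cases "u \<le> v") auto
qed

text \<open>Three diagonal zeros plus six off the diagonal, one for each cubic root and each sign of
  \<open>u - v\<close>. The maximum principle makes the restriction to the unit square
  automatic.\<close>

lemma card_equilibria:
  assumes "0 < a" "a < 1" "0 \<le> d" "d < d_crit a"
  shows "card {(u, v). u \<in> {0..1} \<and> v \<in> {0..1} \<and> G u v a d = 0} = 9"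
proof -
  note disc = cubic_discriminant_neg[OF assms(4)]
  define T where "T = {t. t ^ 3 + cubic_p a d * t + cubic_q a = 0}"
  define w where "w t = sqrt (8 * d - 3 * t\<^sup>2 - 4 * cubic_p a d)" for t
  define f where "f = (\<lambda>(t, \<sigma>). ((t + 2 * (1 + a) / 3 + \<sigma> * w t) / 2,
    (t + 2 * (1 + a) / 3 - \<sigma> * w t) / 2))"
  have T3: "card T = 3"
    unfolding T_def by (rule card_cubic_roots[OF disc])
  \<comment> \<open>An infinite set would have \<open>card\<close> equal to 0.\<close>
  then have finT: "finite T"
    by (metis card.infinite zero_neq_numeral)
  have w: "w t > 0" "(w t)\<^sup>2 = 8 * d - 3 * t\<^sup>2 - 4 * cubic_p a d" if "t \<in> T" for t
    using cubic_root_bound[OF disc, of t] that assms(3) by (auto simp: T_def w_def)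
  have sum: "fst (f (t, \<sigma>)) + snd (f (t, \<sigma>)) = t + 2 * (1 + a) / 3"
    and diff: "fst (f (t, \<sigma>)) - snd (f (t, \<sigma>)) = \<sigma> * w t" for t \<sigma>
    by (simp_all add: f_def field_simps)
  have inj: "inj_on f (T \<times> {1, -1})"
  proof (rule inj_onI, clarify)
    fix t \<sigma> t' \<sigma>'
    assume t: "t \<in> T" and eq: "f (t, \<sigma>) = f (t', \<sigma>')"
    have "t = t'"
      using sum[of t \<sigma>] sum[of t' \<sigma>'] eq by simp
    moreover have "\<sigma> * w t = \<sigma>' * w t'"
      using diff[of t \<sigma>] diff[of t' \<sigma>'] eq by simp
    ultimately show "t = t' \<and> \<sigma> = \<sigma>'"
      using w(1)[OF t] by simp
  qed
  have off: "{(u, v). u \<noteq> v \<and> G u v a d = 0} = f ` (T \<times> {1, -1})"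
  proof (intro equalityI subsetI)
    fix x assume "x \<in> {(u, v). u \<noteq> v \<and> G u v a d = 0}"
    then obtain u v where x: "x = (u, v)" and uv: "u \<noteq> v" and G: "G u v a d = 0"
      by auto
    define t where "t = u + v - 2 * (1 + a) / 3"
    have t: "t \<in> T" and sq: "(u - v)\<^sup>2 = (w t)\<^sup>2"
      using G w(2)[of t] unfolding G_eq_0_off_diagonal[OF uv] T_def t_def by auto
    obtain \<sigma> where \<sigma>: "\<sigma> \<in> {1, -1}" "u - v = \<sigma> * w t"
      using sq unfolding power2_eq_iff by force
    have "x = f (t, \<sigma>)"
      unfolding x f_def using \<sigma>(2)[symmetric] by (simp add: t_def)
    then show "x \<in> f ` (T \<times> {1, -1})"
      using t \<sigma>(1) by blast
  next
    fix x assume "x \<in> f ` (T \<times> {1, -1})"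
    then obtain t \<sigma> where t: "t \<in> T" and \<sigma>: "\<sigma> \<in> {1, -1}" and x: "x = f (t, \<sigma>)"
      by auto
    obtain u v where uv: "f (t, \<sigma>) = (u, v)"
      by fastforce
    have s: "u + v - 2 * (1 + a) / 3 = t" and d: "u - v = \<sigma> * w t"
      using sum[of t \<sigma>] diff[of t \<sigma>] uv by auto
    have ne: "u \<noteq> v"
      using d \<sigma> w(1)[OF t] by auto
    have "(u - v)\<^sup>2 = (w t)\<^sup>2"
      using d \<sigma> by auto
    then have "G u v a d = 0"
      unfolding G_eq_0_off_diagonal[OF ne] s using t w(2)[OF t] by (simp add: T_def)
    then show "x \<in> {(u, v). u \<noteq> v \<and> G u v a d = 0}"
      using ne x uv by simp
  qed
  then have finite_off: "finite {(u, v). u \<noteq> v \<and> G u v a d = 0}"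
    by (simp add: finT)
  have "{(u, v). u \<in> {0..1} \<and> v \<in> {0..1} \<and> G u v a d = 0} = {(u, v). G u v a d = 0}"
    using equilibrium_in_unit_square[OF assms(1-3)] by auto
  also have "\<dots> = {(0, 0), (a, a), (1, 1)} \<union> {(u, v). u \<noteq> v \<and> G u v a d = 0}"
    using G_eq_0_diagonal[of _ a d] by auto
  also have "card \<dots> = card {(0, 0), (a, a), (1, 1)} + card {(u, v). u \<noteq> v \<and> G u v a d = 0}"
    by (rule card_Un_disjoint) (auto simp: finite_off)
  also have "card {(u, v). u \<noteq> v \<and> G u v a d = 0} = 6"
    by (simp add: off card_image[OF inj] card_cartesian_product T3)
  finally show ?thesis
    using assms(1,2) by simp
qed

section \<open>The Jacobian of \<open>G\<close>\<close>

lemma has_derivative_vector_2: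
  assumes "(f has_derivative f') F" "(h has_derivative h') F"
  shows "((\<lambda>x. vector [f x, h x] :: real^2) has_derivative (\<lambda>x. vector [f' x, h' x])) F"
proof -
  \<comment> \<open>In this form the standard rules for sums and scalar multiples apply.\<close>
  have eq: "(vector [x, y] :: real^2) = x *\<^sub>R axis 1 1 + y *\<^sub>R axis 2 1" for x y
    by (simp add: vec_eq_iff forall_2 axis_def)
  show ?thesis
    unfolding eq by (intro derivative_intros assms)
qed

lemma D12G_eq:
  "D12G u v a d =
    vector [vector [2 * (1 + a) * u - 3 * u\<^sup>2 - a - 2 * d, 2 * d],
            vector [2 * d, 2 * (1 + a) * v - 3 * v\<^sup>2 - a - 2 * d]]"
  (is "_ = ?M")
proof -
  have nth: "((\<lambda>x :: real^2. x $ i) has_derivative (\<lambda>h. h $ i)) F" for i F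
    by (intro bounded_linear_imp_has_derivative bounded_linear_vec_nth)
  have "((\<lambda>x :: real^2. G (x $ 1) (x $ 2) a d) has_derivative (*v) ?M) (at (vector [u, v]))"
    unfolding G_def G\<^sub>1_def G\<^sub>2_def g_def
    by (rule has_derivative_eq_rhs[OF has_derivative_vector_2])
      (auto intro!: derivative_eq_intros nth simp: fun_eq_iff vec_eq_iff forall_2
        matrix_vector_mult_def sum_2 power2_eq_square algebra_simps)
  from frechet_derivative_at[OF this, symmetric] show ?thesis
    unfolding D12G_def jacobian_def by (simp only: matrix_of_matrix_vector_mul)
qed

section \<open>The stable branch and assembly of the result\<close>

theorem proposition2p1:
  shows "\<exists>d_bc :: real \<Rightarrow> real.
    continuous_on {0..1} d_bc \<and>
    (\<forall>a\<in>{0..1}. d_bc a \<in> {0..1/24}) \<and>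
    d_bc (1/2) = 1/24 \<and>
    (\<forall>a\<in>{0..1}. d_bc (1 - a) = d_bc a) \<and>
    (\<forall>a d. 0 < a \<and> a < 1 \<and> 0 \<le> d \<and> d < d_bc a \<longrightarrow>
       card {(u, v). u \<in> {0..1} \<and> v \<in> {0..1} \<and> G u v a d = 0} = 9) \<and>
    (\<exists>(u_bc :: real \<times> real \<Rightarrow> real) (v_bc :: real \<times> real \<Rightarrow> real).
       smooth_on (\<Omega>_bc d_bc) (\<lambda>p. (u_bc p, v_bc p)) \<and>
       (\<forall>(a, d)\<in>\<Omega>_bc d_bc.
          u_bc (a, d) \<in> {0<..<1} \<and> v_bc (a, d) \<in> {0<..<1} \<and>
          u_bc (a, d) < a \<and> a < v_bc (a, d) \<and>
          G (u_bc (a, d)) (v_bc (a, d)) a d = 0 \<and>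
          det (D12G (u_bc (a, d)) (v_bc (a, d)) a d) > 0 \<and>
          trace (D12G (u_bc (a, d)) (v_bc (a, d)) a d) < 0))"
proof -
  let ?\<Omega> = "\<Omega>_bc d_crit"
  define T where "T x = mid_root (cubic_p (fst x) (snd x)) (cubic_q (fst x))" for x :: "real \<times> real"
  define W where "W x = sqrt (8 * snd x - 3 * (T x)\<^sup>2 - 4 * cubic_p (fst x) (snd x))"
    for x :: "real \<times> real"
  \<comment> \<open>\<open>U\<close> and \<open>V\<close> solve
    \<open>u + v = t + 2 (1 + a) / 3\<close> and \<open>v - u = W\<close>; the sign is chosen so
    that \<open>U\<close> lies below \<open>V\<close>.\<close>
  define U where "U x = (T x + 2 * (1 + fst x) / 3 - W x) / 2" for x :: "real \<times> real"
  define V where "V x = (T x + 2 * (1 + fst x) / 3 + W x) / 2" for x :: "real \<times> real"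
  have T: "T x ^ 3 + cubic_p (fst x) (snd x) * T x + cubic_q (fst x) = 0"
      "3 * (T x)\<^sup>2 + cubic_p (fst x) (snd x) < 0"
      "3 * (T x)\<^sup>2 + 4 * cubic_p (fst x) (snd x) < 0"
      "0 < 8 * snd x - 3 * (T x)\<^sup>2 - 4 * cubic_p (fst x) (snd x)" if "x \<in> ?\<Omega>" for x
  proof -
    have "snd x < d_crit (fst x)" "0 < snd x"
      using that by (auto simp: \<Omega>_bc_def)
    note disc = cubic_discriminant_neg[OF this(1)]
    note root = mid_root[OF disc, folded T_def]
    show "T x ^ 3 + cubic_p (fst x) (snd x) * T x + cubic_q (fst x) = 0"
      "3 * (T x)\<^sup>2 + cubic_p (fst x) (snd x) < 0"
      by (fact root)+
    show "3 * (T x)\<^sup>2 + 4 * cubic_p (fst x) (snd x) < 0"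
      by (rule cubic_root_bound[OF disc root(1)])
    then show "0 < 8 * snd x - 3 * (T x)\<^sup>2 - 4 * cubic_p (fst x) (snd x)"
      using \<open>0 < snd x\<close> by linarith
  qed
  have "?\<Omega> = {x. 0 < fst x} \<inter> {x. fst x < 1} \<inter> {x. 0 < snd x} \<inter> {x. snd x < d_crit (fst x)}"
    by (auto simp: \<Omega>_bc_def)
  then have "open ?\<Omega>"
    by (auto intro!: open_Int open_Collect_less continuous_intros
        continuous_on_compose2[OF continuous_on_d_crit[of UNIV]])
  have smooth: "smooth_on ?\<Omega> (\<lambda>x. (U x, V x))"
    unfolding smooth_on_def
  proof
    fix k
    have fst: "Ck_on k ?\<Omega> fst" and snd: "Ck_on k ?\<Omega> snd"
      by (auto intro!: Ck_on_bounded_linear \<open>open ?\<Omega>\<close> bounded_linear_fst bounded_linear_snd)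
    have p: "Ck_on k ?\<Omega> (\<lambda>x. cubic_p (fst x) (snd x))"
      unfolding cubic_p_def
      by (intro Ck_on_diff Ck_on_add Ck_on_mult Ck_on_divide Ck_on_power Ck_on_const
          \<open>open ?\<Omega>\<close> fst snd) auto
    have q: "Ck_on k ?\<Omega> (\<lambda>x. cubic_q (fst x))"
      unfolding cubic_q_def
      by (intro Ck_on_diff Ck_on_add Ck_on_mult Ck_on_divide Ck_on_const \<open>open ?\<Omega>\<close> fst) auto
    have T_Ck: "Ck_on k ?\<Omega> T"
      unfolding T_def
      by (intro Ck_on_mid_root \<open>open ?\<Omega>\<close> p q cubic_discriminant_neg) (auto simp: \<Omega>_bc_def)
    have W_Ck: "Ck_on k ?\<Omega> W"
      unfolding W_def
      by (intro Ck_on_sqrt Ck_on_diff Ck_on_mult Ck_on_power Ck_on_const \<open>open ?\<Omega>\<close> T_Ck p snd T(4))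
    show "Ck_on k ?\<Omega> (\<lambda>x. (U x, V x))"
      unfolding U_def V_def
      by (intro Ck_on_Pair Ck_on_divide Ck_on_diff Ck_on_add Ck_on_mult Ck_on_const
          \<open>open ?\<Omega>\<close> T_Ck W_Ck fst) auto
  qed
  have branch: "U (a, d) \<in> {0<..<1} \<and> V (a, d) \<in> {0<..<1} \<and> U (a, d) < a \<and> a < V (a, d) \<and>
      G (U (a, d)) (V (a, d)) a d = 0 \<and> det (D12G (U (a, d)) (V (a, d)) a d) > 0 \<and>
      trace (D12G (U (a, d)) (V (a, d)) a d) < 0" if in_\<Omega>: "(a, d) \<in> ?\<Omega>" for a d
  proof -
    define u v t w p where "u = U (a, d)" and "v = V (a, d)" and "t = T (a, d)"
      and "w = W (a, d)" and "p = cubic_p a d"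
    have ad: "0 < a" "a < 1" "0 < d"
      using in_\<Omega> by (auto simp: \<Omega>_bc_def)
    have t: "t ^ 3 + p * t + cubic_q a = 0" "3 * t\<^sup>2 + p < 0" "3 * t\<^sup>2 + 4 * p < 0"
      using T(1-3)[OF in_\<Omega>] by (auto simp: t_def p_def)
    have w: "w > 0" "w\<^sup>2 = 8 * d - 3 * t\<^sup>2 - 4 * p"
      using T(4)[OF in_\<Omega>] by (auto simp: W_def w_def t_def p_def)
    have u: "u = (t + 2 * (1 + a) / 3 - w) / 2" and v: "v = (t + 2 * (1 + a) / 3 + w) / 2"
      by (auto simp: U_def V_def u_def v_def t_def w_def)
    have "u < v"
      using w(1) unfolding u v by simp
    have s: "u + v - 2 * (1 + a) / 3 = t" and uv: "u - v = - w"
      unfolding u v by (auto simp: field_simps)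
    have G0: "G u v a d = 0"
      using t(1) w(2)
      unfolding G_eq_0_off_diagonal[OF less_imp_neq[OF \<open>u < v\<close>]] s uv p_def by simp
    then have eq: "2 * d * (v - u) + g u a = 0" "2 * d * (u - v) + g v a = 0"
      by (auto simp: G_eq_0_iff G\<^sub>1_def G\<^sub>2_def)
    \<comment> \<open>As \<open>d > 0\<close> and \<open>u < v\<close>, the coupling is strict and
      forces \<open>g u a < 0 < g v a\<close>. This excludes the endpoints 0 and 1, where
      \<open>g\<close> vanishes, and places \<open>u\<close> and \<open>v\<close> on opposite sides
      of \<open>a\<close>.\<close>
    have "2 * d * (v - u) > 0"
      using ad \<open>u < v\<close> by simp
    moreover have "2 * d * (u - v) = - (2 * d * (v - u))"
      by algebra
    ultimately have sgn: "g u a < 0" "g v a > 0"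
      using eq by linarith+
    have unit: "0 \<le> u" "u \<le> 1" "0 \<le> v" "v \<le> 1"
      using equilibrium_in_unit_square[OF ad(1,2) less_imp_le[OF ad(3)] G0] by auto
    have "u \<noteq> 0" "u \<noteq> 1" "v \<noteq> 0" "v \<noteq> 1"
      using sgn by (auto simp: g_def)
    with unit have open_unit: "0 < u" "u < 1" "0 < v" "v < 1"
      by auto
    then have pos: "0 < u * (1 - u)" "0 < v * (1 - v)"
      by auto
    have "u < a" "a < v"
      using sgn pos unfolding g_def by (auto simp: mult_less_0_iff zero_less_mult_iff)
    have M: "det (D12G u v a d) = (3 * t\<^sup>2 + p) * (3 * t\<^sup>2 + 4 * p - 8 * d)"
      "trace (D12G u v a d) = 3 * t\<^sup>2 + 4 * p - 4 * d"
    proof -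
      \<comment> \<open>Completing the square in the derivative of \<open>g\<close>:
        \<open>u - (1 + a) / 3 = (t - w) / 2\<close>, and the maximal slope
        \<open>(1 - a + a^2) / 3\<close> is \<open>6 d - p\<close>.\<close>
      have A: "2 * (1 + a) * u - 3 * u\<^sup>2 - a - 2 * d = 4 * d - p - 3 * (t - w)\<^sup>2 / 4"
        unfolding u p_def cubic_p_def by (simp add: field_simps power2_eq_square)
      have B: "2 * (1 + a) * v - 3 * v\<^sup>2 - a - 2 * d = 4 * d - p - 3 * (t + w)\<^sup>2 / 4"
        unfolding v p_def cubic_p_def by (simp add: field_simps power2_eq_square)
      have "det (D12G u v a d) =
          (4 * d - p - 3 * (t - w)\<^sup>2 / 4) * (4 * d - p - 3 * (t + w)\<^sup>2 / 4) - 2 * d * (2 * d)"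
        unfolding D12G_eq A B det_2 by simp
      \<comment> \<open>Only even powers of \<open>w\<close> survive, so the formula for
        \<open>w^2\<close> can eliminate it.\<close>
      also have "\<dots> = (4 * d - p)\<^sup>2 - 3 / 2 * (4 * d - p) * (t\<^sup>2 + w\<^sup>2) +
          9 / 16 * (t\<^sup>2 - w\<^sup>2)\<^sup>2 - 4 * d\<^sup>2"
        by (simp add: field_simps power2_eq_square)
      also have "\<dots> = (3 * t\<^sup>2 + p) * (3 * t\<^sup>2 + 4 * p - 8 * d)"
        unfolding w(2) by (simp add: field_simps power2_eq_square)
      finally show "det (D12G u v a d) = (3 * t\<^sup>2 + p) * (3 * t\<^sup>2 + 4 * p - 8 * d)" .
      have "trace (D12G u v a d) =
          (4 * d - p - 3 * (t - w)\<^sup>2 / 4) + (4 * d - p - 3 * (t + w)\<^sup>2 / 4)"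
        unfolding D12G_eq A B trace_def sum_2 by simp
      also have "\<dots> = 8 * d - 2 * p - 3 / 2 * (t\<^sup>2 + w\<^sup>2)"
        by (simp add: field_simps power2_eq_square)
      finally show "trace (D12G u v a d) = 3 * t\<^sup>2 + 4 * p - 4 * d"
        unfolding w(2) by (simp add: field_simps)
    qed
    \<comment> \<open>Both factors of the determinant are negative: the first because
      \<open>t\<close> is the middle root, the second by \<open>3 t^2 + 4 p < 0\<close> and
      \<open>d > 0\<close>, which also settles the trace.\<close>
    have "det (D12G u v a d) > 0" "trace (D12G u v a d) < 0"
      unfolding M using t ad by (auto intro!: mult_neg_neg)
    then show ?thesis
      using G0 open_unit \<open>u < a\<close> \<open>a < v\<close> by (simp add: u_def v_def)
  qed
  show ?thesis
  proof (rule exI[of _ d_crit], intro conjI)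
    show "continuous_on {0..1} d_crit"
      by (rule continuous_on_d_crit)
    show "\<forall>a\<in>{0..1}. d_crit a \<in> {0..1/24}"
      using d_crit_bounds by simp
    show "d_crit (1/2) = 1/24"
      by (rule d_crit_half)
    show "\<forall>a\<in>{0..1}. d_crit (1 - a) = d_crit a"
      by (simp add: d_crit_reflect)
    show "\<forall>a d. 0 < a \<and> a < 1 \<and> 0 \<le> d \<and> d < d_crit a \<longrightarrow>
        card {(u, v). u \<in> {0..1} \<and> v \<in> {0..1} \<and> G u v a d = 0} = 9"
      using card_equilibria by blast
  qed (rule exI[of _ U], rule exI[of _ V], use smooth branch in blast)
qed

end
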